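(* For any integer $n\ge0$, $\mathfrak D^2_{2n}(4132)=\mathfrak D^2_{2n}(321)$. Moreover, $|\mathfrak D^2_{2n}(4132)|=C_n$, where $C_n=\frac{1}{n+1}\binom{2n}{n}$ is the $n$th Catalan number. Thus $|\mathfrak D^2_{2n}(4132)|=|\mathfrak D^2_{2n}(3142)|$ for all $n\ge 0$.
   Context: A permutation $\sigma\in\mathfrak S_N$ contains a pattern $\tau\in\mathfrak S_k$ if there are positions $i_1<\dots<i_k$ such that $(\sigma(i_1),\dots,\sigma(i_k))$ is order-isomorphic to $\tau$; otherwise $\sigma$ avoids $\tau$. A Dumont permutation of the second kind is a permutation $\pi\in\mathfrak S_{2n}$ such that $\pi(2i)<2i$ and $\pi(2i-1)\ge 2i-1$ for every $i=1,\dots,n$. $\mathfrak D^2_{2n}$ is the set of these, and $\mathfrak D^2_{2n}(\tau)$ is the subset of those avoiding $\tau$. For $n=0$ the set consists of the empty permutation. *)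

theory Defs
  imports Complex_Main "HOL-Combinatorics.Permutations"
begin

text \<open>
  A permutation of size \<open>N\<close> is a function \<open>\<sigma> :: nat \<Rightarrow> nat\<close> with \<open>\<sigma> permutes {1..N}\<close>; in particular
  positions and values are counted from 1, and the empty permutation is the identity function.
\<close>

definition contains_pattern :: "nat \<Rightarrow> (nat \<Rightarrow> nat) \<Rightarrow> nat \<Rightarrow> (nat \<Rightarrow> nat) \<Rightarrow> bool" where
  "contains_pattern N \<sigma> k \<tau> \<longleftrightarrow>
     (\<exists>i. strict_mono_on {1..k} i \<and> i ` {1..k} \<subseteq> {1..N} \<and>
          (\<forall>a\<in>{1..k}. \<forall>b\<in>{1..k}. \<sigma> (i a) < \<sigma> (i b) \<longleftrightarrow> \<tau> a < \<tau> b))"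

definition avoids_pattern :: "nat \<Rightarrow> (nat \<Rightarrow> nat) \<Rightarrow> nat \<Rightarrow> (nat \<Rightarrow> nat) \<Rightarrow> bool" where
  "avoids_pattern N \<sigma> k \<tau> \<longleftrightarrow> \<not> contains_pattern N \<sigma> k \<tau>"

definition one_line :: "nat list \<Rightarrow> nat \<Rightarrow> nat" where
  "one_line xs i = (if i \<in> {1..length xs} then xs ! (i - 1) else i)"

lemma one_line_permutes:
  assumes "set xs = {1..length xs}"
  shows "one_line xs permutes {1..length xs}"
proof (rule bij_imp_permutes)
  have "one_line xs ` {1..length xs} = {1..length xs}"
  proof -
    have "one_line xs ` {1..length xs} = (\<lambda>j. xs ! j) ` {..<length xs}"
    proof (intro equalityI subsetI)
      fix y assume "y \<in> one_line xs ` {1..length xs}"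
      then obtain i where "i \<in> {1..length xs}" "y = xs ! (i - 1)"
        by (auto simp: one_line_def)
      then show "y \<in> (\<lambda>j. xs ! j) ` {..<length xs}" by force
    next
      fix y assume "y \<in> (\<lambda>j. xs ! j) ` {..<length xs}"
      then obtain j where "j < length xs" "y = xs ! j" by auto
      then have "y = one_line xs (Suc j)" "Suc j \<in> {1..length xs}"
        by (auto simp: one_line_def)
      then show "y \<in> one_line xs ` {1..length xs}" by blast
    qed
    also have "\<dots> = set xs" by (auto simp: set_conv_nth)
    finally show ?thesis using assms by simp
  qed
  then show "bij_betw (one_line xs) {1..length xs} {1..length xs}"
    by (simp add: bij_betw_def eq_card_imp_inj_on)
qed (auto simp: one_line_def)

definition dumont2 :: "nat \<Rightarrow> (nat \<Rightarrow> nat) set" where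
  "dumont2 n = {\<pi>. \<pi> permutes {1..2 * n} \<and>
     (\<forall>i\<in>{1..n}. \<pi> (2 * i) < 2 * i \<and> \<pi> (2 * i - 1) \<ge> 2 * i - 1)}"

text \<open>The pattern is given in one-line notation: 4132 is the list \<open>[4, 1, 3, 2]\<close>.\<close>

definition dumont2_avoiding :: "nat \<Rightarrow> nat list \<Rightarrow> (nat \<Rightarrow> nat) set" where
  "dumont2_avoiding n xs =
     {\<pi> \<in> dumont2 n. avoids_pattern (2 * n) \<pi> (length xs) (one_line xs)}"

definition catalan :: "nat \<Rightarrow> real" where
  "catalan n = 1 / (real n + 1) * real ((2 * n) choose n)"

end

theory Submission
  imports Defs
begin

text \<open>
  In a Dumont permutation of the second kind, every entry at an even position \<open>p\<close> has an entry
  \<open>\<ge> p\<close> to its left, so a leftmost start \<open>i\<close> of a 321 pattern is odd. The entry at \<open>i + 1\<close>, which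
  is at most \<open>i\<close>, either extends the pattern to 4132 or is itself the middle of a 321 pattern; the
  latter confines too many entries left of \<open>i\<close> to too few values. Hence avoiding 4132 and avoiding
  321 are equivalent.

  A 321-avoiding such permutation is increasing on the even and on the odd positions, so it is
  determined by its set of values at even positions, and the sets that arise are exactly those
  satisfying the ballot condition. A 3142-avoiding one has the form \<open>2k + 2, 1, \<sigma>', \<tau>'\<close>, where \<open>\<sigma>'\<close>
  and \<open>\<tau>'\<close> come from smaller 3142-avoiding ones, which gives the Catalan convolution.
\<close>

section \<open>Pattern containment by explicit positions\<close>

lemma contains_321_iff:
  "contains_pattern N \<pi> (length [3::nat, 2, 1]) (one_line [3, 2, 1]) \<longleftrightarrow>
     (\<exists>i j k. 1 \<le> i \<and> i < j \<and> j < k \<and> k \<le> N \<and> \<pi> k < \<pi> j \<and> \<pi> j < \<pi> i)"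
  (is "?L \<longleftrightarrow> ?R")
proof
  have I: "{1..length [3::nat, 2, 1]} = {1, 2, 3}" by auto
  show ?R if ?L
  proof -
    from that obtain f where f: "strict_mono_on {1, 2, 3} f" "f ` {1, 2, 3} \<subseteq> {1..N}"
      "\<forall>a\<in>{1, 2, 3}. \<forall>b\<in>{1, 2, 3}. \<pi> (f a) < \<pi> (f b) \<longleftrightarrow> one_line [3, 2, 1] a < one_line [3, 2, 1] b"
      unfolding contains_pattern_def I by auto
    from f(1) have "f 1 < f 2" "f 2 < f 3" by (auto simp: strict_mono_on_def)
    moreover from f(3) have "\<pi> (f 3) < \<pi> (f 2)" "\<pi> (f 2) < \<pi> (f 1)"
      by (auto simp: one_line_def)
    ultimately show ?thesis using f(2) by (intro exI[of _ "f 1"] exI[of _ "f 2"] exI[of _ "f 3"]) auto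
  qed
  show ?L if ?R
  proof -
    from that obtain i j k where h: "1 \<le> i" "i < j" "j < k" "k \<le> N" "\<pi> k < \<pi> j" "\<pi> j < \<pi> i" by auto
    show ?thesis unfolding contains_pattern_def I
      \<comment> \<open>\<open>one_line\<close> doubles as the position function, counted from 1,
        that sends 1, 2, 3 to \<open>i\<close>, \<open>j\<close>, \<open>k\<close>.\<close>
      by (rule exI[of _ "one_line [i, j, k]"])
        (use h in \<open>auto simp: one_line_def strict_mono_on_def\<close>)
  qed
qed

lemma All_less_4_iff: "(\<forall>a<4. P a) \<longleftrightarrow> P 0 \<and> P 1 \<and> P 2 \<and> P (3::nat)"
  by (auto simp: numeral_eq_Suc less_Suc_eq)

text \<open>Leaving the pattern \<open>s\<close> arbitrary serves 4132 and 3142 at once; for a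
  concrete \<open>s\<close> the order condition is a finite conjunction that linear arithmetic
  collapses to a chain of three inequalities.\<close>

lemma contains_4_iff:
  fixes s :: "nat list"
  assumes s: "length s = 4"
  shows "contains_pattern N \<pi> (length s) (one_line s) \<longleftrightarrow>
     (\<exists>i j k l. 1 \<le> i \<and> i < j \<and> j < k \<and> k < l \<and> l \<le> N \<and>
        (\<forall>a<4. \<forall>b<4. \<pi> ([i, j, k, l] ! a) < \<pi> ([i, j, k, l] ! b) \<longleftrightarrow> s ! a < s ! b))"
  (is "?L \<longleftrightarrow> ?R")
proof
  have I: "{1..length s} = {1, 2, 3, 4}" using s by auto
  show ?R if ?L
  proof -
    from that obtain f where f: "strict_mono_on {1, 2, 3, 4} f" "f ` {1, 2, 3, 4} \<subseteq> {1..N}"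
      "\<forall>a\<in>{1, 2, 3, 4}. \<forall>b\<in>{1, 2, 3, 4}. \<pi> (f a) < \<pi> (f b) \<longleftrightarrow> one_line s a < one_line s b"
      unfolding contains_pattern_def I by blast
    from f(1) have "f 1 < f 2" "f 2 < f 3" "f 3 < f 4" by (auto simp: strict_mono_on_def)
    then show ?thesis using f(2,3) s unfolding All_less_4_iff
      by (intro exI[of _ "f 1"] exI[of _ "f 2"] exI[of _ "f 3"] exI[of _ "f 4"])
        (simp add: one_line_def)
  qed
  show ?L if ?R
  proof -
    from that obtain i j k l where h: "1 \<le> i" "i < j" "j < k" "k < l" "l \<le> N" 
       "\<forall>a<4. \<forall>b<4. \<pi> ([i, j, k, l] ! a) < \<pi> ([i, j, k, l] ! b) \<longleftrightarrow> s ! a < s ! b" by blast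
    show ?thesis unfolding contains_pattern_def I
    proof (intro exI[of _ "one_line [i, j, k, l]"] conjI)
      show "strict_mono_on {1, 2, 3, 4} (one_line [i, j, k, l])"
        using h(1-4) by (auto simp: one_line_def strict_mono_on_def)
      show "one_line [i, j, k, l] ` {1, 2, 3, 4} \<subseteq> {1..N}"
        using h(1-5) by (simp add: one_line_def)
      show "\<forall>a\<in>{1, 2, 3, 4}. \<forall>b\<in>{1, 2, 3, 4}.
          \<pi> (one_line [i, j, k, l] a) < \<pi> (one_line [i, j, k, l] b) \<longleftrightarrow> one_line s a < one_line s b"
        using h(6) s by (simp add: one_line_def All_less_4_iff)
    qed
  qed
qed

lemma contains_4132_iff:
  "contains_pattern N \<pi> (length [4::nat, 1, 3, 2]) (one_line [4, 1, 3, 2]) \<longleftrightarrow>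
     (\<exists>i j k l. 1 \<le> i \<and> i < j \<and> j < k \<and> k < l \<and> l \<le> N \<and> \<pi> j < \<pi> l \<and> \<pi> l < \<pi> k \<and> \<pi> k < \<pi> i)"
proof -
  have "(\<forall>a<4. \<forall>b<4. \<pi> ([i, j, k, l] ! a) < \<pi> ([i, j, k, l] ! b) \<longleftrightarrow> [4, 1, 3, 2] ! a < [4, 1, 3, 2::nat] ! b)
     \<longleftrightarrow> \<pi> j < \<pi> l \<and> \<pi> l < \<pi> k \<and> \<pi> k < \<pi> i" for i j k l :: nat
    by (simp add: All_less_4_iff) linarith
  then show ?thesis by (subst contains_4_iff) simp_all
qed

lemma contains_3142_iff:
  "contains_pattern N \<pi> (length [3::nat, 1, 4, 2]) (one_line [3, 1, 4, 2]) \<longleftrightarrow>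
     (\<exists>i j k l. 1 \<le> i \<and> i < j \<and> j < k \<and> k < l \<and> l \<le> N \<and> \<pi> j < \<pi> l \<and> \<pi> l < \<pi> i \<and> \<pi> i < \<pi> k)"
proof -
  have "(\<forall>a<4. \<forall>b<4. \<pi> ([i, j, k, l] ! a) < \<pi> ([i, j, k, l] ! b) \<longleftrightarrow> [3, 1, 4, 2] ! a < [3, 1, 4, 2::nat] ! b)
     \<longleftrightarrow> \<pi> j < \<pi> l \<and> \<pi> l < \<pi> i \<and> \<pi> i < \<pi> k" for i j k l :: nat
    by (simp add: All_less_4_iff) linarith
  then show ?thesis by (subst contains_4_iff) simp_all
qed

section \<open>Inequalities satisfied by Dumont permutations of the second kind\<close>

lemma dumont2_permutes: "\<pi> \<in> dumont2 n \<Longrightarrow> \<pi> permutes {1..2 * n}"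
  by (simp add: dumont2_def)

lemma dumont2_even:
  assumes "\<pi> \<in> dumont2 n" "even p" "1 \<le> p" "p \<le> 2 * n"
  shows "\<pi> p < p"
  using assms by (auto simp: dumont2_def elim!: evenE)

lemma dumont2_odd:
  assumes "\<pi> \<in> dumont2 n" "odd p" "p \<le> 2 * n"
  shows "p \<le> \<pi> p"
proof -
  from \<open>odd p\<close> obtain i where "p = 2 * i + 1" by (elim oddE)
  with assms show ?thesis by (force simp: dumont2_def dest!: bspec[of _ _ "Suc i"])
qed

lemma dumont2I:
  assumes "\<pi> permutes {1..2 * n}"
    and "\<And>p. even p \<Longrightarrow> 1 \<le> p \<Longrightarrow> p \<le> 2 * n \<Longrightarrow> \<pi> p < p"
    and "\<And>p. odd p \<Longrightarrow> p \<le> 2 * n \<Longrightarrow> p \<le> \<pi> p"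
  shows "\<pi> \<in> dumont2 n"
  using assms by (auto simp: dumont2_def)

text \<open>Pigeonhole: otherwise the first \<open>p\<close> entries would all lie among the
  \<open>p - 1\<close> values below \<open>p\<close>.\<close>

lemma ex_earlier_ge:
  fixes \<pi> :: "nat \<Rightarrow> nat"
  assumes \<pi>: "\<pi> permutes {1..N}" and "1 \<le> p" "p \<le> N" "\<pi> p < p"
  obtains q where "1 \<le> q" "q < p" "p \<le> \<pi> q"
proof -
  have "\<exists>q\<in>{1..<p}. p \<le> \<pi> q"
  proof (rule ccontr)
    assume neg: "\<not> ?thesis"
    have "\<pi> ` {1..p} \<subseteq> {1..p - 1}"
    proof (clarify)
      fix q assume q: "q \<in> {1..p}"
      then have "\<pi> q \<in> {1..N}" using permutes_in_image[OF \<pi>, of q] \<open>p \<le> N\<close> by auto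
      moreover have "\<pi> q < p" using q neg \<open>\<pi> p < p\<close> by (cases "q = p") force+
      ultimately show "\<pi> q \<in> {1..p - 1}" by auto
    qed
    then have "card (\<pi> ` {1..p}) \<le> p - 1" using card_mono[of "{1..p - 1}"] by fastforce
    then show False using \<open>1 \<le> p\<close> permutes_inj_on[OF \<pi>] by (simp add: card_image)
  qed
  then show thesis using that by auto
qed

section \<open>Equivalence of avoiding 4132 and avoiding 321\<close>

lemma dumont2_4132_eq_321: "dumont2_avoiding n [4, 1, 3, 2] = dumont2_avoiding n [3, 2, 1]"
proof -
  have "contains_pattern (2 * n) \<pi> (length [4::nat, 1, 3, 2]) (one_line [4, 1, 3, 2])"
    if D: "\<pi> \<in> dumont2 n"
      and c: "contains_pattern (2 * n) \<pi> (length [3::nat, 2, 1]) (one_line [3, 2, 1])" for \<pi>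
  proof -
    note \<pi> = dumont2_permutes[OF D]
    note inj_iff = inj_eq[OF permutes_inj[OF \<pi>]]
    define P where "P i \<longleftrightarrow> 1 \<le> i \<and> (\<exists>j k. i < j \<and> j < k \<and> k \<le> 2 * n \<and> \<pi> k < \<pi> j \<and> \<pi> j < \<pi> i)" for i
    have ex: "\<exists>i. P i" using c unfolding contains_321_iff P_def by blast
    define i where "i = (LEAST i. P i)"
    have "P i" using ex unfolding i_def by (rule LeastI_ex)
    then obtain j k where i: "1 \<le> i" "i < j" "j < k" "k \<le> 2 * n" "\<pi> k < \<pi> j" "\<pi> j < \<pi> i"
      unfolding P_def by blast
    have leftmost: "\<not> P q" if "q < i" for q
      using not_less_Least that unfolding i_def by blast
    have "odd i"
    proof
      assume "even i"
      then have "\<pi> i < i" using dumont2_even[OF D] i by simp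
      then obtain q where "1 \<le> q" "q < i" "i \<le> \<pi> q" using ex_earlier_ge[OF \<pi>, of i] i by auto
      \<comment> \<open>Here \<open>\<pi> j < \<pi> i < i \<le> \<pi> q\<close>, so
        \<open>q\<close>, \<open>j\<close>, \<open>k\<close> form a 321 that starts left of
        \<open>i\<close>.\<close>
      then have "P q" unfolding P_def using i \<open>\<pi> i < i\<close> \<open>1 \<le> q\<close> \<open>q < i\<close> \<open>i \<le> \<pi> q\<close>
        by (intro conjI exI[of _ j] exI[of _ k]) auto
      then show False using leftmost \<open>q < i\<close> by blast
    qed
    then have ge: "i \<le> \<pi> i" using dumont2_odd[OF D] i by simp
    define d where "d = \<pi> (Suc i)"
    have "d \<le> i" using dumont2_even[OF D, of "Suc i"] \<open>odd i\<close> i by (simp add: d_def)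
    moreover have "d \<noteq> \<pi> i" by (simp add: d_def inj_iff)
    ultimately have "d < \<pi> i" using ge by simp
    have "d \<noteq> \<pi> k" using i by (simp add: d_def inj_iff)
    have "\<not> \<pi> k < d"
    proof
      assume "\<pi> k < d"
      \<comment> \<open>An entry above \<open>d\<close> left of \<open>i\<close> would start a 321
        with \<open>Suc i\<close> and \<open>k\<close>. So the \<open>i\<close> entries at these
        positions would have to share the \<open>d - 1 \<le> i - 1\<close> values below
        \<open>d\<close>.\<close>
      have "\<pi> ` (insert k {1..<i}) \<subseteq> {1..d - 1}"
      proof clarify
        fix q assume q: "q \<in> insert k {1..<i}"
        then have "\<pi> q \<in> {1..2 * n}" using permutes_in_image[OF \<pi>, of q] i by auto
        moreover have "\<pi> q < d"
        proof (cases "q = k")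
          case False
          with q have "1 \<le> q" "q < i" by auto
          then have "\<not> d < \<pi> q" using leftmost[of q] \<open>\<pi> k < d\<close> i
            unfolding P_def d_def by (auto dest!: spec[of _ "Suc i"])
          moreover have "d \<noteq> \<pi> q" using \<open>q < i\<close> by (simp add: d_def inj_iff)
          ultimately show ?thesis by simp
        qed (use \<open>\<pi> k < d\<close> in simp)
        ultimately show "\<pi> q \<in> {1..d - 1}" by auto
      qed
      then have "card (\<pi> ` (insert k {1..<i})) \<le> d - 1"
        using card_mono[of "{1..d - 1}"] by fastforce
      then show False using i \<open>d \<le> i\<close> \<open>\<pi> k < d\<close>
        by (simp add: card_image[OF permutes_inj_on[OF \<pi>]] del: image_insert)
    qed
    with \<open>d \<noteq> \<pi> k\<close> have "d < \<pi> k" by simp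
    \<comment> \<open>Since \<open>\<pi> j > \<pi> k > d\<close>, the positions \<open>i\<close>,
      \<open>Suc i\<close>, \<open>j\<close>, \<open>k\<close> are distinct and form a 4132.\<close>
    with i have "j \<noteq> Suc i" by (auto simp: d_def)
    with i have "Suc i < j" by simp
    with i \<open>d < \<pi> k\<close> show ?thesis unfolding contains_4132_iff d_def
      by (intro exI[of _ i] exI[of _ "Suc i"] exI[of _ j] exI[of _ k]) auto
  qed
  moreover have "contains_pattern (2 * n) \<pi> (length [3::nat, 2, 1]) (one_line [3, 2, 1])"
    if c: "contains_pattern (2 * n) \<pi> (length [4::nat, 1, 3, 2]) (one_line [4, 1, 3, 2])" for \<pi>
  proof -
    from c obtain i j k l where "1 \<le> i" "i < j" "j < k" "k < l" "l \<le> 2 * n"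
      "\<pi> j < \<pi> l" "\<pi> l < \<pi> k" "\<pi> k < \<pi> i" unfolding contains_4132_iff by blast
    then show ?thesis unfolding contains_321_iff
      by (intro exI[of _ i] exI[of _ k] exI[of _ l]) auto
  qed
  ultimately show ?thesis unfolding dumont2_avoiding_def avoids_pattern_def by blast
qed

section \<open>Catalan numbers and their convolution\<close>

lemma catalan_0: "catalan 0 = 1"
  by (simp add: catalan_def)

text \<open>Both sides are compared after writing the central binomials with factorials. The product
  form, free of division, allows rewriting under the sum in the convolution.\<close>

lemma catalan_Suc: "(real n + 2) * catalan (Suc n) = (4 * real n + 2) * catalan n"
proof -
  have C: "real ((2 * m) choose m) = fact (2 * m) / (fact m * fact m)" for m
    by (subst binomial_fact) simp_all
  have "fact (2 * Suc n) = (2 * real n + 2) * (2 * real n + 1) * fact (2 * n)"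
    by (simp add: algebra_simps)
  moreover have "fact (Suc n) = (real n + 1) * fact n"
    by (simp add: algebra_simps)
  ultimately show ?thesis
    unfolding catalan_def C
    by (simp add: divide_simps del: fact_Suc mult_Suc_right) (simp add: algebra_simps)
qed

text \<open>
  By symmetry, weighting the terms of the convolution by their index \<open>i\<close> multiplies the sum by
  \<open>n / 2\<close>; the two-term recurrence for the Catalan numbers relates the weighted sums for \<open>n\<close> and
  \<open>n + 1\<close>.
\<close>

lemma catalan_convolution: "(\<Sum>i\<le>n. catalan i * catalan (n - i)) = catalan (Suc n)"
proof -
  define S where "S n = (\<Sum>i\<le>n. catalan i * catalan (n - i))" for n
  define T where "T n = (\<Sum>i\<le>n. real i * (catalan i * catalan (n - i)))" for n
  have T: "2 * T n = real n * S n" for n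
  proof -
    have "T n = (\<Sum>i\<le>n. real (n - i) * (catalan i * catalan (n - i)))"
      unfolding T_def
      by (rule sum.reindex_bij_witness[of _ "\<lambda>i. n - i" "\<lambda>i. n - i"]) auto
    then have "2 * T n = (\<Sum>i\<le>n. real i * (catalan i * catalan (n - i)))
        + (\<Sum>i\<le>n. real (n - i) * (catalan i * catalan (n - i)))"
      using T_def[of n] by linarith
    also have "\<dots> = (\<Sum>i\<le>n. (real i + real (n - i)) * (catalan i * catalan (n - i)))"
      by (simp only: sum.distrib distrib_right)
    also have "\<dots> = (\<Sum>i\<le>n. real n * (catalan i * catalan (n - i)))"
      by (rule sum.cong) (simp_all flip: of_nat_add)
    finally show ?thesis by (simp add: S_def sum_distrib_left)
  qed
  have "S n = catalan (Suc n)"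
  proof (induction n)
    case 0
    show ?case using catalan_Suc[of 0] by (simp add: S_def catalan_0)
  next
    case (Suc n)
    \<comment> \<open>Adding \<open>S (Suc n)\<close> raises each weight from \<open>i\<close> to
      \<open>i + 1\<close>. Once the term \<open>i = 0\<close> is split off and the index shifted,
      \<open>catalan (Suc i)\<close> carries the weight \<open>i + 2\<close>, as the two-term
      recurrence requires.\<close>
    have "T (Suc n) + S (Suc n) = (\<Sum>i\<le>Suc n. (real i + 1) * (catalan i * catalan (Suc n - i)))"
      by (simp add: T_def S_def sum.distrib distrib_right del: sum.atMost_Suc)
    also have "\<dots> = catalan (Suc n) + (\<Sum>i\<le>n. ((real i + 2) * catalan (Suc i)) * catalan (n - i))"
      by (subst sum.atMost_Suc_shift) (simp add: catalan_0 algebra_simps)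
    also have "(\<Sum>i\<le>n. ((real i + 2) * catalan (Suc i)) * catalan (n - i)) = 4 * T n + 2 * S n"
      unfolding catalan_Suc T_def S_def
      by (simp add: sum_distrib_left algebra_simps flip: sum.distrib)
    finally have "2 * T (Suc n) + 2 * S (Suc n) = 2 * catalan (Suc n) + 8 * T n + 4 * S n" by simp
    then have "(real n + 3) * S (Suc n) = (4 * real n + 6) * catalan (Suc n)"
      using T[of n] T[of "Suc n"] Suc by (simp add: algebra_simps)
    also have "\<dots> = (real n + 3) * catalan (Suc (Suc n))"
      using catalan_Suc[of "Suc n"] by (simp add: algebra_simps)
    finally show ?case by (smt (verit) mult_left_cancel of_nat_0_le_iff)
  qed
  then show ?thesis by (simp add: S_def)
qed

section \<open>Counting ballot sets\<close>

text \<open>A set encodes a lattice word of length \<open>N\<close> whose up-steps are at the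
  positions in \<open>S\<close>: every prefix has at least as many up-steps as down-steps. The size
  \<open>q\<close> is independent of \<open>N\<close> so that induction on \<open>N\<close> is
  possible.\<close>

definition ballot_sets :: "nat \<Rightarrow> nat \<Rightarrow> nat set set" where
  "ballot_sets N q = {S. S \<subseteq> {1..N} \<and> card S = q \<and> (\<forall>m\<le>N. m \<le> 2 * card (S \<inter> {1..m}))}"

lemma finite_ballot_sets: "finite (ballot_sets N q)"
  by (rule finite_subset[of _ "Pow {1..N}"]) (auto simp: ballot_sets_def)

lemma ballot_sets_eq_empty: "2 * q < N \<Longrightarrow> ballot_sets N q = {}"
  by (force simp: ballot_sets_def Int_absorb2)

text \<open>The sets are split by whether they contain \<open>Suc N\<close>. The assumption is the
  prefix condition at \<open>m = Suc N\<close>, the only one not inherited from length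
  \<open>N\<close>.\<close>

lemma ballot_sets_Suc:
  assumes "Suc N \<le> 2 * Suc q"
  shows "ballot_sets (Suc N) (Suc q) = ballot_sets N (Suc q) \<union> insert (Suc N) ` ballot_sets N q"
proof (intro equalityI subsetI)
  fix S assume S: "S \<in> ballot_sets (Suc N) (Suc q)"
  show "S \<in> ballot_sets N (Suc q) \<union> insert (Suc N) ` ballot_sets N q"
  proof (cases "Suc N \<in> S")
    case False
    then have "S \<subseteq> {1..N}" using S by (force simp: ballot_sets_def le_Suc_eq)
    then show ?thesis using S by (auto simp: ballot_sets_def)
  next
    case True
    let ?S = "S - {Suc N}"
    have "?S \<inter> {1..m} = S \<inter> {1..m}" if "m \<le> N" for m using that by auto
    then have "?S \<in> ballot_sets N q" using S True
      by (force simp: ballot_sets_def le_Suc_eq card_Diff_singleton)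
    then show ?thesis using True by (auto intro!: image_eqI[of _ _ ?S])
  qed
next
  fix S assume "S \<in> ballot_sets N (Suc q) \<union> insert (Suc N) ` ballot_sets N q"
  then show "S \<in> ballot_sets (Suc N) (Suc q)"
  proof
    assume S: "S \<in> ballot_sets N (Suc q)"
    then have "S \<subseteq> {1..Suc N}" by (auto simp: ballot_sets_def)
    then show ?thesis using S assms by (auto simp: ballot_sets_def le_Suc_eq Int_absorb2)
  next
    assume "S \<in> insert (Suc N) ` ballot_sets N q"
    then obtain R where R: "R \<in> ballot_sets N q" "S = insert (Suc N) R" by auto
    then have "Suc N \<notin> R" "finite R" by (auto simp: ballot_sets_def intro: finite_subset)
    then have "card S = Suc q" "S \<subseteq> {1..Suc N}" using R by (auto simp: ballot_sets_def)
    moreover have "S \<inter> {1..m} = R \<inter> {1..m}" if "m \<le> N" for m using that R by auto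
    ultimately show ?thesis using R assms by (auto simp: ballot_sets_def le_Suc_eq Int_absorb2)
  qed
qed

text \<open>The difference of binomials obeys the same Pascal recursion as the ballot sets. On the
  boundary \<open>N = 2 * q + 1\<close> both sides vanish: no ballot set exists, and the two
  binomials agree by symmetry. The range includes this boundary because the recursion can step onto
  it.\<close>

lemma card_ballot_sets:
  "N \<le> 2 * q + 1 \<Longrightarrow> real (card (ballot_sets N q)) = real (N choose q) - real (N choose Suc q)"
proof (induction N arbitrary: q)
  case 0
  have "ballot_sets 0 q = (if q = 0 then {{}} else {})" by (auto simp: ballot_sets_def)
  then show ?case by simp
next
  case (Suc N)
  show ?case
  proof (cases "Suc N = 2 * q + 1")
    case True
    then show ?thesis using ballot_sets_eq_empty[of q "Suc N"] binomial_symmetric[of q "Suc N"] by simp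
  next
    case False
    with Suc.prems obtain r where r: "q = Suc r" "Suc N \<le> 2 * Suc r" by (cases q) auto
    have notin: "Suc N \<notin> S" if "S \<in> ballot_sets N m" for S m
      using that by (auto simp: ballot_sets_def)
    have "inj_on (insert (Suc N)) (ballot_sets N r)"
      using notin by (intro inj_onI) (metis insert_ident)
    then have "card (ballot_sets (Suc N) q) = card (ballot_sets N q) + card (ballot_sets N r)"
      unfolding r(1) ballot_sets_Suc[OF r(2)] using notin
      by (subst card_Un_disjoint) (auto simp: finite_ballot_sets card_image)
    then show ?thesis using Suc.IH[of q] Suc.IH[of r] r by simp
  qed
qed

lemma card_ballot_sets_eq_catalan: "real (card (ballot_sets (2 * n) n)) = catalan n"
proof -
  \<comment> \<open>This ratio turns the difference of the two binomials into
    \<open>1 / (n + 1)\<close> times the central one.\<close>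
  have "Suc n * ((2 * n) choose Suc n) = n * ((2 * n) choose n)"
  proof (cases n)
    case (Suc m)
    then show ?thesis using Suc_times_binomial_add[of "Suc m" m] by (simp add: mult_2)
  qed simp
  then have *: "(real n + 1) * real ((2 * n) choose Suc n) = real n * real ((2 * n) choose n)"
    by (metis of_nat_Suc of_nat_mult add.commute)
  have "(real n + 1) * real (card (ballot_sets (2 * n) n)) = real ((2 * n) choose n)"
    using * card_ballot_sets[of "2 * n" n] by (simp add: right_diff_distrib) (simp add: distrib_right)
  then show ?thesis by (simp add: catalan_def field_simps)
qed

section \<open>321-avoiding Dumont permutations and ballot sets\<close>

text \<open>Both lists of values are the sorted list of the common image. Thus an increasing
  subsequence can be recovered from its set of values.\<close>

lemma strict_mono_on_image_eq_imp_eq: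
  fixes f g :: "nat \<Rightarrow> nat"
  assumes "strict_mono_on {1..n} f" "strict_mono_on {1..n} g" "f ` {1..n} = g ` {1..n}" "i \<in> {1..n}"
  shows "f i = g i"
proof -
  have *: "map h [1..<Suc n] = sorted_list_of_set (h ` {1..n})"
    if h: "strict_mono_on {1..n} h" for h :: "nat \<Rightarrow> nat"
  proof -
    have "sorted_wrt (<) (map h [1..<Suc n])"
      unfolding sorted_wrt_map
      by (rule sorted_wrt_mono_rel[OF _ sorted_wrt_upt])
        (use h in \<open>auto simp: strict_mono_on_def\<close>)
    moreover have "card (h ` {1..n}) = n"
      using strict_mono_on_imp_inj_on[OF h] by (simp add: card_image)
    moreover have "set (map h [1..<Suc n]) = h ` {1..n}" by auto
    ultimately show ?thesis
      by (metis sorted_list_of_set_unique finite_atLeastAtMost finite_imageI length_map length_upt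
          diff_Suc_1)
  qed
  have "map f [1..<Suc n] = map g [1..<Suc n]" using assms by (simp only: *)
  then show ?thesis using assms(4) by (simp del: upt_Suc)
qed

lemma ex_strict_mono_on_enumeration:
  fixes S :: "nat set"
  assumes "finite S"
  obtains f where "strict_mono_on {1..card S} f" "f ` {1..card S} = S"
proof
  let ?f = "\<lambda>i. sorted_list_of_set S ! (i - 1)"
  show "strict_mono_on {1..card S} ?f"
  proof (rule strict_mono_onI)
    fix i j assume "i \<in> {1..card S}" "j \<in> {1..card S}" "i < j"
    then show "?f i < ?f j"
      by (intro sorted_wrt_nth_less[OF strict_sorted_list_of_set]) auto
  qed
  have "?f ` {1..card S} = (!) (sorted_list_of_set S) ` {0..<card S}"
  proof -
    have "{0..<card S} = (\<lambda>i. i - 1) ` {1..card S}"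
      by (force simp: image_iff intro!: bexI[of _ "Suc _"])
    then show ?thesis by (simp add: image_image)
  qed
  also have "\<dots> = S" using assms by (simp add: nth_image)
  finally show "?f ` {1..card S} = S" .
qed

text \<open>A descent between even positions extends to a 321 on the left, by the larger entry from
  \<open>ex_earlier_ge\<close>; a descent between odd positions extends on the right, by
  counting.\<close>

lemma dumont2_321_mono_on:
  assumes D: "\<pi> \<in> dumont2_avoiding n [3, 2, 1]"
  shows "strict_mono_on {1..n} (\<lambda>i. \<pi> (2 * i))" and "strict_mono_on {1..n} (\<lambda>i. \<pi> (2 * i - 1))"
proof -
  have D2: "\<pi> \<in> dumont2 n"
    and av: "\<And>i j k. 1 \<le> i \<Longrightarrow> i < j \<Longrightarrow> j < k \<Longrightarrow> k \<le> 2 * n \<Longrightarrow> \<pi> k < \<pi> j \<Longrightarrow> \<pi> j < \<pi> i \<Longrightarrow> False"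
    using D contains_321_iff[of "2 * n" \<pi>] unfolding dumont2_avoiding_def avoids_pattern_def by blast+
  note \<pi> = dumont2_permutes[OF D2]
  note inj_iff = inj_eq[OF permutes_inj[OF \<pi>]]
  show "strict_mono_on {1..n} (\<lambda>i. \<pi> (2 * i))"
  proof (rule strict_mono_onI, rule ccontr)
    fix i j assume ij: "i \<in> {1..n}" "j \<in> {1..n}" "i < j" "\<not> \<pi> (2 * i) < \<pi> (2 * j)"
    then have "\<pi> (2 * j) < \<pi> (2 * i)" using inj_iff[of "2 * i" "2 * j"] by simp
    moreover have lt: "\<pi> (2 * i) < 2 * i" using dumont2_even[OF D2, of "2 * i"] ij by simp
    then obtain p where "1 \<le> p" "p < 2 * i" "2 * i \<le> \<pi> p"
      using ex_earlier_ge[OF \<pi>, of "2 * i"] ij by auto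
    ultimately show False using av[of p "2 * i" "2 * j"] ij lt by simp
  qed
  show "strict_mono_on {1..n} (\<lambda>i. \<pi> (2 * i - 1))"
  proof (rule strict_mono_onI, rule ccontr)
    fix i j assume ij: "i \<in> {1..n}" "j \<in> {1..n}" "i < j" "\<not> \<pi> (2 * i - 1) < \<pi> (2 * j - 1)"
    define p q where "p = 2 * i - 1" and "q = 2 * j - 1"
    have pq: "1 \<le> p" "p < q" "q < 2 * n" "odd q" using ij by (auto simp: p_def q_def)
    have lt: "\<pi> q < \<pi> p" using ij(4) pq inj_iff[of p q] unfolding p_def[symmetric] q_def[symmetric] by simp
    have ge: "q \<le> \<pi> q" using dumont2_odd[OF D2 \<open>odd q\<close>] pq by simp
    \<comment> \<open>Without a 321 through \<open>p\<close> and \<open>q\<close>, no entry right of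
      \<open>q\<close> is below \<open>\<pi> q\<close>. So \<open>2 * n - q + 1\<close> entries
      would have to fit into \<open>2 * n - \<pi> q \<le> 2 * n - q\<close> values.\<close>
    have "\<pi> ` insert p {q<..2 * n} \<subseteq> {\<pi> q<..2 * n}"
    proof clarify
      fix k assume k: "k \<in> insert p {q<..2 * n}"
      then have "\<pi> k \<in> {1..2 * n}" using permutes_in_image[OF \<pi>, of k] pq by auto
      moreover have "\<pi> q < \<pi> k"
      proof (cases "k = p")
        case False
        then have "q < k" "k \<le> 2 * n" using k by auto
        then show ?thesis using av[of p q k] inj_iff[of k q] pq lt by force
      qed (use lt in simp)
      ultimately show "\<pi> k \<in> {\<pi> q<..2 * n}" by simp
    qed
    then have "card (\<pi> ` insert p {q<..2 * n}) \<le> 2 * n - \<pi> q"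
      using card_mono[of "{\<pi> q<..2 * n}"] by fastforce
    then show False using pq ge by (simp add: card_image[OF permutes_inj_on[OF \<pi>]] del: image_insert)
  qed
qed

text \<open>Through this complement the values at even positions also fix the set of values at odd
  positions.\<close>

lemma image_odd_eq:
  fixes n :: nat
  assumes \<pi>: "\<pi> permutes {1..2 * n}"
  shows "(\<lambda>i. \<pi> (2 * i - 1)) ` {1..n} = {1..2 * n} - (\<lambda>i. \<pi> (2 * i)) ` {1..n}"
proof -
  have split: "(\<lambda>i. 2 * i - 1) ` {1..n} = {1..2 * n} - (\<lambda>i. 2 * i) ` {1..n}"
  proof (intro equalityI subsetI)
    fix p :: nat assume p: "p \<in> {1..2 * n} - (\<lambda>i. 2 * i) ` {1..n}"
    then have "odd p" by (auto elim!: evenE)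
    then obtain i where "p = 2 * i + 1" by (elim oddE)
    then show "p \<in> (\<lambda>i. 2 * i - 1) ` {1..n}" using p by (intro image_eqI[of _ _ "Suc i"]) auto
  qed (auto, presburger)
  have "(\<lambda>i. \<pi> (2 * i - 1)) ` {1..n} = \<pi> ` ({1..2 * n} - (\<lambda>i. 2 * i) ` {1..n})"
    unfolding split[symmetric] image_image ..
  also have "\<dots> = \<pi> ` {1..2 * n} - (\<lambda>i. \<pi> (2 * i)) ` {1..n}"
    by (simp add: image_set_diff[OF permutes_inj[OF \<pi>]] image_image)
  finally show ?thesis by (simp only: permutes_image[OF \<pi>])
qed

text \<open>The preimage of \<open>S\<close> is built by writing \<open>S\<close> increasingly at
  the even positions and its complement increasingly at the odd ones. The prefix condition yields
  both Dumont inequalities.\<close>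

lemma ballot_setsE:
  assumes S: "S \<in> ballot_sets (2 * n) n"
  obtains \<pi> where "\<pi> \<in> dumont2_avoiding n [3, 2, 1]" "(\<lambda>i. \<pi> (2 * i)) ` {1..n} = S"
proof -
  let ?R = "{1..2 * n} - S"
  have S': "S \<subseteq> {1..2 * n}" "card S = n" "\<And>m. m \<le> 2 * n \<Longrightarrow> m \<le> 2 * card (S \<inter> {1..m})"
    using S by (auto simp: ballot_sets_def)
  then have fin: "finite S" by (meson finite_atLeastAtMost finite_subset)
  have R: "card ?R = n" using S' fin by (simp add: card_Diff_subset)
  obtain f where f: "strict_mono_on {1..n} f" "f ` {1..n} = S"
    using ex_strict_mono_on_enumeration[OF fin] S'(2) by metis
  obtain g where g: "strict_mono_on {1..n} g" "g ` {1..n} = ?R"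
    using ex_strict_mono_on_enumeration[of ?R] R by (metis finite_Diff finite_atLeastAtMost)
  define \<pi> where "\<pi> p = (if p \<in> {1..2 * n} then if even p then f (p div 2) else g (Suc p div 2) else p)" for p
  have idx: "p div 2 \<in> {1..n}" if "even p" "p \<in> {1..2 * n}" for p
    using that by (auto elim!: evenE)
  have idx': "Suc p div 2 \<in> {1..n}" if "odd p" "p \<in> {1..2 * n}" for p
    using that by (auto elim!: oddE)
  have ev: "\<pi> p = f (p div 2)" "\<pi> p \<in> S" if "even p" "p \<in> {1..2 * n}" for p
    using that f(2) idx[OF that] by (auto simp: \<pi>_def)
  have od: "\<pi> p = g (Suc p div 2)" "\<pi> p \<in> ?R" if "odd p" "p \<in> {1..2 * n}" for p
    using that g(2) idx'[OF that] by (auto simp: \<pi>_def)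
  have mono: "\<pi> p < \<pi> q" if "p < q" "p \<in> {1..2 * n}" "q \<in> {1..2 * n}" "even p = even q" for p q
  proof (cases "even p")
    case True
    then have "p div 2 < q div 2" using that by (auto elim!: evenE)
    then show ?thesis using True that ev(1) f(1) idx by (simp add: strict_mono_on_def)
  next
    case False
    then have "Suc p div 2 < Suc q div 2" using that by (auto elim!: oddE)
    then show ?thesis using False that od(1) g(1) idx' by (simp add: strict_mono_on_def)
  qed
  have perm: "\<pi> permutes {1..2 * n}"
  proof (rule inj_imp_permutes)
    show "\<pi> p \<in> {1..2 * n}" if "p \<in> {1..2 * n}" for p
      using ev(2)[OF _ that] od(2)[OF _ that] S'(1) by (cases "even p") blast+
    show "inj_on \<pi> {1..2 * n}"
    proof (rule linorder_inj_onI)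
      fix p q assume pq: "p < q" "p \<in> {1..2 * n}" "q \<in> {1..2 * n}"
      show "\<pi> p \<noteq> \<pi> q"
        using mono[OF pq] ev(2)[of p] ev(2)[of q] od(2)[of p] od(2)[of q] pq
        by (cases "even p"; cases "even q") auto
    qed auto
  qed (auto simp: \<pi>_def)
  have "\<pi> \<in> dumont2 n"
  proof (rule dumont2I[OF perm])
    fix p assume p: "even p" "1 \<le> p" "p \<le> 2 * n"
    then obtain i where i: "p = 2 * i" by (elim evenE)
    show "\<pi> p < p"
    proof (rule ccontr)
      assume neg: "\<not> \<pi> p < p"
      \<comment> \<open>As \<open>f i \<ge> p\<close>, only the first \<open>i - 1\<close> elements
        of \<open>S\<close> can lie below \<open>p = 2 * i\<close>, whereas the prefix condition at
        \<open>2 * i - 1\<close> demands at least \<open>i\<close>.\<close>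
      have "S \<inter> {1..p - 1} \<subseteq> f ` {1..<i}"
      proof
        fix s assume s: "s \<in> S \<inter> {1..p - 1}"
        then obtain j where j: "j \<in> {1..n}" "s = f j" using f(2) by auto
        have "f j < f i" using s j neg ev(1)[of p] p i by auto
        moreover have "f i < f j" if "i < j" using that j p i by (intro strict_mono_onD[OF f(1)]) auto
        ultimately have "j < i" by (metis linorder_neqE_nat order_less_asym)
        then show "s \<in> f ` {1..<i}" using j by auto
      qed
      then have "card (S \<inter> {1..p - 1}) \<le> card (f ` {1..<i})" by (intro card_mono) auto
      also have "\<dots> \<le> i - 1" using card_image_le[of "{1..<i}" f] by simp
      finally have "card (S \<inter> {1..p - 1}) \<le> i - 1" .
      moreover have "p - 1 \<le> 2 * card (S \<inter> {1..p - 1})" using S'(3)[of "p - 1"] p by linarith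
      ultimately show False using p i by linarith
    qed
  next
    fix p assume p: "odd p" "p \<le> 2 * n"
    then obtain i where i: "p = 2 * i + 1" by (elim oddE)
    show "p \<le> \<pi> p"
    proof (rule ccontr)
      assume neg: "\<not> p \<le> \<pi> p"
      \<comment> \<open>The \<open>i + 1\<close> smallest elements of the complement would lie in
        \<open>{1..2 * i}\<close>, where the prefix condition leaves room for at most
        \<open>i\<close>.\<close>
      have "g ` {1..Suc i} \<subseteq> {1..2 * i} - S"
      proof clarify
        fix j assume j: "j \<in> {1..Suc i}"
        then have "g j \<in> ?R" using g(2) p i by auto
        moreover have "g j \<le> g (Suc i)" using j p i g(1)
          by (cases "j = Suc i") (auto simp: strict_mono_on_def intro!: less_imp_le)
        then have "g j \<le> 2 * i" using neg od(1)[of p] p i by auto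
        ultimately show "g j \<in> {1..2 * i} - S" by auto
      qed
      then have "card (g ` {1..Suc i}) \<le> card ({1..2 * i} - S)" by (intro card_mono) auto
      moreover have "inj_on g {1..Suc i}"
        using strict_mono_on_imp_inj_on[OF g(1)] p i by (auto intro: inj_on_subset)
      moreover have "card ({1..2 * i} - S) = 2 * i - card (S \<inter> {1..2 * i})"
        by (simp add: card_Diff_subset_Int Int_commute)
      ultimately show False using S'(3)[of "2 * i"] p i by (simp add: card_image)
    qed
  qed
  moreover have "\<not> contains_pattern (2 * n) \<pi> (length [3::nat, 2, 1]) (one_line [3, 2, 1])"
    unfolding contains_321_iff
  proof clarify
    fix i j k assume h: "1 \<le> i" "i < j" "j < k" "k \<le> 2 * n" "\<pi> k < \<pi> j" "\<pi> j < \<pi> i"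
    \<comment> \<open>Two of the three positions share a parity, and \<open>\<pi>\<close> increases
      on each parity class.\<close>
    have "even i = even j \<or> even j = even k \<or> even i = even k" by blast
    then show False using h mono[of i j] mono[of j k] mono[of i k] by auto
  qed
  moreover have "(\<lambda>i. \<pi> (2 * i)) ` {1..n} = S"
    unfolding f(2)[symmetric] by (intro image_cong) (auto simp: \<pi>_def)
  ultimately show thesis using that by (simp add: dumont2_avoiding_def avoids_pattern_def)
qed

lemma card_dumont2_321: "card (dumont2_avoiding n [3, 2, 1]) = card (ballot_sets (2 * n) n)"
proof (rule bij_betw_same_card, rule bij_betw_imageI)
  let ?\<Phi> = "\<lambda>\<pi>. (\<lambda>i. \<pi> (2 * i)) ` {1..n}"
  show "inj_on ?\<Phi> (dumont2_avoiding n [3, 2, 1])"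
  proof (intro inj_onI ext)
    fix \<pi> \<rho> :: "nat \<Rightarrow> nat" and p
    assume h: "\<pi> \<in> dumont2_avoiding n [3, 2, 1]" "\<rho> \<in> dumont2_avoiding n [3, 2, 1]" "?\<Phi> \<pi> = ?\<Phi> \<rho>"
    then have perm: "\<pi> permutes {1..2 * n}" "\<rho> permutes {1..2 * n}"
      using dumont2_permutes unfolding dumont2_avoiding_def by blast+
    show "\<pi> p = \<rho> p"
    proof (cases "p \<in> {1..2 * n}")
      case False
      then show ?thesis using perm by (simp add: permutes_not_in)
    next
      case p: True
      show ?thesis
      proof (cases "even p")
        case True
        then obtain i where "p = 2 * i" by (elim evenE)
        then show ?thesis
          using p strict_mono_on_image_eq_imp_eq[OF h(1,2)[THEN dumont2_321_mono_on(1)] h(3), of i] by simp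
      next
        case False
        then obtain i where "p = 2 * i + 1" by (elim oddE)
        moreover have "(\<lambda>i. \<pi> (2 * i - 1)) ` {1..n} = (\<lambda>i. \<rho> (2 * i - 1)) ` {1..n}"
          using h(3) perm by (simp only: image_odd_eq)
        ultimately show ?thesis
          using p strict_mono_on_image_eq_imp_eq[OF h(1,2)[THEN dumont2_321_mono_on(2)], of "Suc i"] by simp
      qed
    qed
  qed
  show "?\<Phi> ` dumont2_avoiding n [3, 2, 1] = ballot_sets (2 * n) n"
  proof (intro equalityI subsetI)
    fix S assume "S \<in> ?\<Phi> ` dumont2_avoiding n [3, 2, 1]"
    then obtain \<pi> where D: "\<pi> \<in> dumont2 n" and S: "S = ?\<Phi> \<pi>" by (auto simp: dumont2_avoiding_def)
    note \<pi> = dumont2_permutes[OF D]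
    have inj: "inj_on (\<lambda>i. \<pi> (2 * i)) A" for A
      by (simp add: inj_on_def inj_eq[OF permutes_inj[OF \<pi>]])
    have rng: "\<pi> (2 * i) \<in> {1..2 * n}" if "i \<in> {1..n}" for i
      using permutes_in_image[OF \<pi>, of "2 * i"] that by simp
    have "m \<le> 2 * card (S \<inter> {1..m})" if "m \<le> 2 * n" for m
    proof -
      \<comment> \<open>The entry at an even position \<open>2 * i \<le> Suc m\<close> is below
        \<open>2 * i\<close>, hence at most \<open>m\<close>; there are \<open>Suc m div 2\<close>
        such positions.\<close>
      have "(\<lambda>i. \<pi> (2 * i)) ` {1..Suc m div 2} \<subseteq> S \<inter> {1..m}"
      proof clarify
        fix i assume i: "i \<in> {1..Suc m div 2}"
        then have "i \<in> {1..n}" "2 * i \<le> Suc m" using that by auto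
        then show "\<pi> (2 * i) \<in> S \<inter> {1..m}"
          using rng[of i] dumont2_even[OF D, of "2 * i"] by (auto simp: S)
      qed
      from card_mono[OF _ this] have "Suc m div 2 \<le> card (S \<inter> {1..m})"
        by (simp add: card_image[OF inj])
      then show ?thesis by linarith
    qed
    then show "S \<in> ballot_sets (2 * n) n"
      using rng by (auto simp: ballot_sets_def S card_image[OF inj])
  next
    fix S assume "S \<in> ballot_sets (2 * n) n"
    then show "S \<in> ?\<Phi> ` dumont2_avoiding n [3, 2, 1]" by (elim ballot_setsE) blast
  qed
qed

section \<open>Decomposition of 3142-avoiding Dumont permutations\<close>

text \<open>
  The permutation \<open>2k + 2, 1, \<sigma>', \<tau>'\<close> in one-line notation, where \<open>\<sigma>'\<close> is the reverse complement
  of \<open>\<sigma>\<close> placed on positions \<open>3, \<dots>, 2k + 2\<close> and values \<open>2, \<dots>, 2k + 1\<close>, and \<open>\<tau>'\<close> is \<open>\<tau>\<close>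
  shifted by \<open>2k + 2\<close>. Since the values of \<open>\<sigma>'\<close> lie one below its positions, it is the reverse
  complement, which fixes the pattern 3142, that restores the Dumont condition.
\<close>

definition combine :: "nat \<Rightarrow> (nat \<Rightarrow> nat) \<Rightarrow> (nat \<Rightarrow> nat) \<Rightarrow> nat \<Rightarrow> nat" where
  "combine k \<sigma> \<tau> p =
     (if p = 0 then 0 else if p = 1 then 2 * k + 2 else if p = 2 then 1
      else if p \<le> 2 * k + 2 then 2 * k + 2 - \<sigma> (2 * k + 3 - p)
      else 2 * k + 2 + \<tau> (p - (2 * k + 2)))"

lemma dumont2_3142_iff:
  "\<pi> \<in> dumont2_avoiding n [3, 1, 4, 2] \<longleftrightarrow> \<pi> \<in> dumont2 n \<and>
     \<not> (\<exists>i j k l. 1 \<le> i \<and> i < j \<and> j < k \<and> k < l \<and> l \<le> 2 * n \<and>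
        \<pi> j < \<pi> l \<and> \<pi> l < \<pi> i \<and> \<pi> i < \<pi> k)"
  unfolding dumont2_avoiding_def avoids_pattern_def mem_Collect_eq contains_3142_iff ..

text \<open>Positions up to \<open>M\<close> carry values up to \<open>M\<close>, later ones carry
  larger values, and the leading \<open>M\<close> and 1 cannot take part in a 3142. So an occurrence
  would lie wholly in the copy of \<sigma> or wholly in that of \<tau>.\<close>

lemma combine_mem:
  assumes k: "k \<le> n" and \<sigma>: "\<sigma> \<in> dumont2_avoiding k [3, 1, 4, 2]"
    and \<tau>: "\<tau> \<in> dumont2_avoiding (n - k) [3, 1, 4, 2]"
  shows "combine k \<sigma> \<tau> \<in> dumont2_avoiding (Suc n) [3, 1, 4, 2]"
proof -
  define M where "M = 2 * k + 2"
  define \<pi> where "\<pi> = combine k \<sigma> \<tau>"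
  \<comment> \<open>With these, \<open>\<pi> p\<close> is \<open>M - s p\<close> on the middle block
    and \<open>M + t p\<close> on the last one.\<close>
  define s t where "s p = \<sigma> (M + 1 - p)" and "t p = \<tau> (p - M)" for p
  have \<sigma>D: "\<sigma> \<in> dumont2 k" and \<tau>D: "\<tau> \<in> dumont2 (n - k)"
    using \<sigma> \<tau> by (auto simp: dumont2_avoiding_def)
  note \<sigma>p = dumont2_permutes[OF \<sigma>D] and \<tau>p = dumont2_permutes[OF \<tau>D]
  have \<sigma>_rng: "1 \<le> \<sigma> q \<and> \<sigma> q \<le> 2 * k" if "1 \<le> q" "q \<le> 2 * k" for q
    using permutes_in_image[OF \<sigma>p, of q] that by simp
  have \<tau>_rng: "1 \<le> \<tau> q \<and> \<tau> q \<le> 2 * (n - k)" if "1 \<le> q" "q \<le> 2 * (n - k)" for q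
    using permutes_in_image[OF \<tau>p, of q] that by simp
  have M: "even M" "M \<le> 2 * Suc n" "M \<ge> 2" "2 * (n - k) = 2 * Suc n - M" using k by (auto simp: M_def)
  have \<pi>1: "\<pi> 1 = M" and \<pi>2: "\<pi> 2 = 1" by (simp_all add: \<pi>_def combine_def M_def)
  have mid: "\<pi> p + s p = M \<and> 1 \<le> s p \<and> s p + 2 \<le> M" if "3 \<le> p" "p \<le> M" for p
  proof -
    have "2 * k + 2 = M" "2 * k + 3 = M + 1" by (simp_all add: M_def)
    then have "\<pi> p = M - s p" using that by (simp only: \<pi>_def combine_def s_def) simp
    moreover have "1 \<le> M + 1 - p" "M + 1 - p \<le> 2 * k" using that by (auto simp: M_def)
    then have "1 \<le> s p" "s p \<le> 2 * k" unfolding s_def using \<sigma>_rng by blast+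
    ultimately show ?thesis unfolding M_def by simp
  qed
  have hi: "\<pi> p = M + t p" if "M < p" for p
    using that M by (simp add: \<pi>_def combine_def M_def t_def)
  have hi_rng: "1 \<le> t p \<and> M + t p \<le> 2 * Suc n" if "M < p" "p \<le> 2 * Suc n" for p
  proof -
    have "1 \<le> p - M" "p - M \<le> 2 * (n - k)" using that M by auto
    then have "1 \<le> t p" "t p \<le> 2 * (n - k)" unfolding t_def using \<tau>_rng by blast+
    then show ?thesis using that M(4) by simp
  qed
  have lo_rng: "1 \<le> \<pi> p \<and> \<pi> p \<le> M" if "1 \<le> p" "p \<le> M" for p
  proof -
    consider "p = 1" | "p = 2" | "3 \<le> p" using \<open>1 \<le> p\<close> by linarith
    then show ?thesis using \<pi>1 \<pi>2 mid[of p] that M by cases auto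
  qed
  have mid_eq: "2 \<le> \<pi> p \<and> \<pi> p < M" if "3 \<le> p" "p \<le> M" for p
    using mid[OF that] that by linarith
  have "\<pi> permutes {1..2 * Suc n}"
  proof (rule inj_imp_permutes)
    show "\<pi> p \<in> {1..2 * Suc n}" if "p \<in> {1..2 * Suc n}" for p
    proof (cases "p \<le> M")
      case True
      then show ?thesis using lo_rng[of p] that M by simp
    next
      case False
      then show ?thesis using hi[of p] hi_rng[of p] that M by auto
    qed
    show "inj_on \<pi> {1..2 * Suc n}"
    proof (rule linorder_inj_onI)
      fix p q assume pq: "p < q" "p \<in> {1..2 * Suc n}" "q \<in> {1..2 * Suc n}"
      consider "q \<le> M" "p = 1" | "q \<le> M" "p = 2" | "q \<le> M" "3 \<le> p" | "M < q" "p \<le> M" | "M < p"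
        using pq by fastforce
      then show "\<pi> p \<noteq> \<pi> q"
      proof cases
        case 1
        then have "q = 2 \<or> 3 \<le> q" using pq by auto
        then show ?thesis using 1 \<pi>1 \<pi>2 mid_eq[of q] M by auto
      next
        case 2
        then show ?thesis using pq \<pi>2 mid_eq[of q] by auto
      next
        case 3
        then have "s p \<noteq> s q"
          using pq by (auto simp: s_def inj_eq[OF permutes_inj[OF \<sigma>p]])
        then show ?thesis using 3 pq mid[of p] mid[of q] by linarith
      next
        case 4
        then show ?thesis using pq lo_rng[of p] hi[of q] hi_rng[of q] by auto
      next
        case 5
        then have "t p \<noteq> t q"
          using pq by (auto simp: t_def inj_eq[OF permutes_inj[OF \<tau>p]])
        then show ?thesis using 5 pq hi[of p] hi[of q] by simp
      qed
    qed auto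
    show "\<pi> p = p" if "p \<notin> {1..2 * Suc n}" for p
    proof (cases "p = 0")
      case False
      then have "2 * Suc n < p" using that by auto
      moreover from this have "t p = p - M"
        unfolding t_def using M by (intro permutes_not_in[OF \<tau>p]) auto
      ultimately show ?thesis using hi[of p] M by simp
    qed (simp add: \<pi>_def combine_def)
  qed simp
  then have "\<pi> \<in> dumont2 (Suc n)"
  proof (rule dumont2I)
    fix p assume p: "even p" "1 \<le> p" "p \<le> 2 * Suc n"
    consider "p = 2" | "3 \<le> p" "p \<le> M" | "M < p" using p by fastforce
    then show "\<pi> p < p"
    proof cases
      case 2
      \<comment> \<open>Reversal sends the even position \<open>p\<close> to the odd position
        \<open>M + 1 - p\<close>, and complementing turns the inequality around:
        \<open>\<pi> p = M - s p \<le> p - 1\<close>.\<close>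
      then have "M + 1 - p \<le> s p"
        unfolding s_def using p M by (intro dumont2_odd[OF \<sigma>D]) (auto simp: M_def)
      then show ?thesis using mid[of p] 2 p by linarith
    next
      case 3
      then have "t p < p - M"
        unfolding t_def using p M by (intro dumont2_even[OF \<tau>D]) auto
      then show ?thesis using hi[of p] 3 by simp
    qed (simp add: \<pi>2)
  next
    fix p assume p: "odd p" "p \<le> 2 * Suc n"
    consider "p = 1" | "3 \<le> p" "p \<le> M" | "M < p" using p by (cases "p = 2"; cases "p = 0") fastforce+
    then show "p \<le> \<pi> p"
    proof cases
      case 2
      then have "s p < M + 1 - p"
        unfolding s_def using p M by (intro dumont2_even[OF \<sigma>D]) (auto simp: M_def)
      then show ?thesis using mid[of p] 2 by linarith
    next
      case 3
      then have "p - M \<le> t p"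
        unfolding t_def using p M by (intro dumont2_odd[OF \<tau>D]) auto
      then show ?thesis using hi[of p] 3 by simp
    qed (use \<pi>1 M in simp)
  qed
  moreover have False
    if h: "1 \<le> i" "i < j" "j < k'" "k' < l" "l \<le> 2 * Suc n" "\<pi> j < \<pi> l" "\<pi> l < \<pi> i" "\<pi> i < \<pi> k'"
    for i j k' l
  proof (cases "l \<le> M")
    case True
    \<comment> \<open>Positions 1 and 2 hold the maximum and the minimum of the block, but the first
      entry of a 3142 is neither extreme.\<close>
    have "i \<noteq> 1" using h lo_rng[of k'] True \<pi>1 by auto
    moreover have "i \<noteq> 2" using h lo_rng[of j] True \<pi>2 by auto
    ultimately have "3 \<le> i" using h by simp
    then have "s k' < s i" "s i < s l"
      "s l < s j"
      using h True mid[of i] mid[of j] mid[of k'] mid[of l] by linarith+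
    moreover have "M + 1 - l < M + 1 - k'" "M + 1 - k' < M + 1 - j" "M + 1 - j < M + 1 - i"
      "1 \<le> M + 1 - l" "M + 1 - i \<le> 2 * k"
      using h True \<open>3 \<le> i\<close> by (auto simp: M_def)
    ultimately show False using \<sigma> unfolding dumont2_3142_iff s_def by blast
  next
    case False
    then have "M < \<pi> l" using hi[of l] hi_rng[of l] h by simp
    then have "M < i" using h lo_rng[of i] by (cases "i \<le> M") auto
    then have "t j < t l" "t l < t i" "t i < t k'"
      using h hi[of i] hi[of j] hi[of k'] hi[of l] by linarith+
    moreover have "1 \<le> i - M" "i - M < j - M" "j - M < k' - M" "k' - M < l - M" "l - M \<le> 2 * (n - k)"
      using h \<open>M < i\<close> M by auto
    ultimately show False using \<tau> unfolding dumont2_3142_iff t_def by blast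
  qed
  ultimately show ?thesis unfolding dumont2_3142_iff \<pi>_def by blast
qed

text \<open>The entry at position 1 reveals \<open>k\<close>, after which both components can be
  read back from their blocks.\<close>

lemma combine_inject:
  assumes "\<sigma> permutes {1..2 * k}" "\<tau> permutes {1..2 * m}" "\<sigma>' permutes {1..2 * k'}" "\<tau>' permutes {1..2 * m'}"
    and eq: "combine k \<sigma> \<tau> = combine k' \<sigma>' \<tau>'"
  shows "k = k' \<and> \<sigma> = \<sigma>' \<and> \<tau> = \<tau>'"
proof -
  from fun_cong[OF eq, of 1] have k: "k = k'" by (simp add: combine_def)
  have "\<sigma> q = \<sigma>' q" for q
  proof (cases "q \<in> {1..2 * k}")
    case True
    then have "\<sigma> q \<in> {1..2 * k}" "\<sigma>' q \<in> {1..2 * k}"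
      using permutes_in_image[OF assms(1), of q] permutes_in_image[OF assms(3), of q] k by simp_all
    then show ?thesis using fun_cong[OF eq, of "2 * k + 3 - q"] True k
      by (auto simp: combine_def split: if_splits)
  next
    case False
    then show ?thesis using assms k by (simp add: permutes_not_in)
  qed
  moreover have "\<tau> q = \<tau>' q" for q
  proof (cases "q = 0")
    case True
    then show ?thesis using assms by (simp add: permutes_not_in)
  next
    case False
    then show ?thesis using fun_cong[OF eq, of "q + (2 * k + 2)"] k by (simp add: combine_def)
  qed
  ultimately show ?thesis using k by blast
qed

text \<open>With \<open>x = \<pi> 1\<close> and \<open>\<pi> 2 = 1\<close>, avoidance forces all
  later values below \<open>x\<close> to precede those above \<open>x\<close>: a large value before
  a small one would extend \<open>x\<close>, 1 to a 3142. This cuts the permutation after position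
  \<open>x\<close>.\<close>

lemma combineE:
  assumes \<pi>: "\<pi> \<in> dumont2_avoiding (Suc n) [3, 1, 4, 2]"
  obtains k \<sigma> \<tau> where "k \<le> n" "\<sigma> \<in> dumont2_avoiding k [3, 1, 4, 2]"
    "\<tau> \<in> dumont2_avoiding (n - k) [3, 1, 4, 2]" "\<pi> = combine k \<sigma> \<tau>"
proof -
  have D: "\<pi> \<in> dumont2 (Suc n)"
    and av: "\<And>i j k l. 1 \<le> i \<Longrightarrow> i < j \<Longrightarrow> j < k \<Longrightarrow> k < l \<Longrightarrow> l \<le> 2 * Suc n \<Longrightarrow>
       \<pi> j < \<pi> l \<Longrightarrow> \<pi> l < \<pi> i \<Longrightarrow> \<pi> i < \<pi> k \<Longrightarrow> False"
    using \<pi> unfolding dumont2_3142_iff by blast+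
  note p = dumont2_permutes[OF D]
  note inj_iff = inj_eq[OF permutes_inj[OF p]]
  define x where "x = \<pi> 1"
  have rng: "1 \<le> \<pi> p \<and> \<pi> p \<le> 2 * Suc n" if "1 \<le> p" "p \<le> 2 * Suc n" for p
    using permutes_in_image[OF p, of p] that by simp
  have \<pi>2: "\<pi> 2 = 1" using dumont2_even[OF D, of 2] rng[of 2] by simp
  have x: "2 \<le> x" "x \<le> 2 * Suc n"
    using rng[of 1] inj_iff[of 1 2] \<pi>2 by (auto simp: x_def)
  have neq: "\<pi> p \<noteq> x" "\<pi> p \<noteq> 1" if "3 \<le> p" for p
    using that inj_iff[of p 1] inj_iff[of p 2] \<pi>2 by (auto simp: x_def)
  define L where "L = {p \<in> {3..2 * Suc n}. \<pi> p < x}"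
  have down: "q \<in> L" if "p \<in> L" "3 \<le> q" "q \<le> p" for p q
  proof (rule ccontr)
    assume "q \<notin> L"
    with that have "x < \<pi> q" "q < p" "\<pi> p < x" "p \<le> 2 * Suc n"
      using neq(1)[of q] by (auto simp: L_def intro: le_neq_implies_less)
    moreover have "1 < \<pi> p" using rng[of p] neq(2)[of p] that by (simp add: L_def)
    ultimately show False using av[of 1 2 q p] that \<pi>2 by (simp add: x_def)
  qed
  \<comment> \<open>This gives \<open>L\<close> exactly \<open>x - 2\<close> elements; being an
    initial segment of the positions from 3 on, it is \<open>{3..x}\<close>.\<close>
  have "\<pi> ` insert 2 L = {1..x - 1}"
  proof (intro equalityI subsetI)
    fix v assume "v \<in> \<pi> ` insert 2 L"
    then obtain p where "v = \<pi> p" "p = 2 \<or> p \<in> L" by auto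
    then show "v \<in> {1..x - 1}" using rng[of p] \<pi>2 x by (auto simp: L_def)
  next
    fix v assume v: "v \<in> {1..x - 1}"
    then have "v \<in> \<pi> ` {1..2 * Suc n}" using permutes_image[OF p] x by auto
    then obtain p where p: "v = \<pi> p" "1 \<le> p" "p \<le> 2 * Suc n" by auto
    then have "p \<noteq> 1" using v by (auto simp: x_def)
    then have "p = 2 \<or> p \<in> L" using p v by (auto simp: L_def)
    then show "v \<in> \<pi> ` insert 2 L" using p by auto
  qed
  then have "card (insert 2 L) = x - 1"
    using card_image[OF permutes_inj_on[OF p], of "insert 2 L"] by simp
  moreover have "finite L" "2 \<notin> L" by (auto simp: L_def)
  ultimately have cardL: "card L = x - 2" by simp
  have L_iff: "\<pi> p < x \<longleftrightarrow> p \<le> x" if "3 \<le> p" "p \<le> 2 * Suc n" for p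
  proof
    assume "\<pi> p < x"
    with that have "{3..p} \<subseteq> L" using down[of p] by (auto simp: L_def)
    then have "card {3..p} \<le> x - 2" using card_mono[OF \<open>finite L\<close>] cardL by metis
    then show "p \<le> x" using that by simp
  next
    assume "p \<le> x"
    show "\<pi> p < x"
    proof (rule ccontr)
      assume "\<not> \<pi> p < x"
      then have "p \<notin> L" by (simp add: L_def)
      have "L \<subseteq> {3..<p}"
      proof
        fix q assume q: "q \<in> L"
        then have "\<not> p \<le> q" using down[OF q, of p] \<open>p \<notin> L\<close> that by blast
        then show "q \<in> {3..<p}" using q by (simp add: L_def)
      qed
      then have "card L \<le> card {3..<p}" by (intro card_mono) auto
      then show False using cardL \<open>p \<le> x\<close> that by simp
    qed
  qed
  \<comment> \<open>For odd \<open>x\<close>, the entry at the even position \<open>x + 1\<close>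
    would be at most \<open>x\<close> by the Dumont condition and at least \<open>x\<close> by
    \<open>L_iff\<close>, but \<open>x\<close> is already taken at position 1.\<close>
  have "even x"
  proof (rule ccontr)
    assume "odd x"
    then have x': "3 \<le> x" "x + 1 \<le> 2 * Suc n" using x by presburger+
    then have "\<pi> (x + 1) < x + 1" using dumont2_even[OF D, of "x + 1"] \<open>odd x\<close> by simp
    moreover have "\<not> \<pi> (x + 1) < x" using L_iff[of "x + 1"] x' by simp
    ultimately show False using neq(1)[of "x + 1"] x' by simp
  qed
  then obtain k' where "x = 2 * k'" by (elim evenE)
  define k where "k = k' - 1"
  have xk: "x = 2 * k + 2" using x \<open>x = 2 * k'\<close> by (simp add: k_def)
  then have k: "k \<le> n" using x by simp
  have lo: "2 \<le> \<pi> p \<and> \<pi> p < x" if "3 \<le> p" "p \<le> x" for p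
    using L_iff[of p] rng[of p] neq(2)[of p] that x by simp
  have hi: "x < \<pi> p \<and> \<pi> p \<le> 2 * Suc n" if "x < p" "p \<le> 2 * Suc n" for p
    using L_iff[of p] rng[of p] neq(1)[of p] that x by simp
  \<comment> \<open>These invert the placement in \<open>combine\<close>; the default
    \<open>q\<close> off the range is what \<open>permutes\<close> demands.\<close>
  define \<sigma> where "\<sigma> q = (if q \<in> {1..2 * k} then x - \<pi> (x + 1 - q) else q)" for q
  define \<tau> where "\<tau> q = (if q \<in> {1..2 * (n - k)} then \<pi> (q + x) - x else q)" for q
  have \<sigma>: "\<sigma> q + \<pi> (x + 1 - q) = x" "1 \<le> \<sigma> q" "\<sigma> q \<le> 2 * k" if "1 \<le> q" "q \<le> 2 * k" for q
  proof -
    have "3 \<le> x + 1 - q" "x + 1 - q \<le> x" using that by (auto simp: xk)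
    from lo[OF this] that show "\<sigma> q + \<pi> (x + 1 - q) = x" "1 \<le> \<sigma> q" "\<sigma> q \<le> 2 * k"
      by (auto simp: \<sigma>_def xk)
  qed
  have \<tau>: "\<tau> q + x = \<pi> (q + x)" "1 \<le> \<tau> q" "\<tau> q \<le> 2 * (n - k)" if "1 \<le> q" "q \<le> 2 * (n - k)" for q
  proof -
    have "x < q + x" "q + x \<le> 2 * Suc n" using that k by (auto simp: xk)
    from hi[OF this] that k show "\<tau> q + x = \<pi> (q + x)" "1 \<le> \<tau> q" "\<tau> q \<le> 2 * (n - k)"
      by (auto simp: \<tau>_def xk)
  qed
  have "\<sigma> permutes {1..2 * k}"
  proof (rule inj_imp_permutes)
    show "inj_on \<sigma> {1..2 * k}"
    proof (rule inj_onI)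
      fix q r assume h: "q \<in> {1..2 * k}" "r \<in> {1..2 * k}" "\<sigma> q = \<sigma> r"
      then have "\<pi> (x + 1 - q) = \<pi> (x + 1 - r)" using \<sigma>(1)[of q] \<sigma>(1)[of r] by auto
      then show "q = r" using h by (auto simp: inj_iff xk)
    qed
  qed (use \<sigma> in \<open>auto simp: \<sigma>_def\<close>)
  then have "\<sigma> \<in> dumont2 k"
  proof (rule dumont2I)
    fix q assume q: "even q" "1 \<le> q" "q \<le> 2 * k"
    then have "x + 1 - q \<le> \<pi> (x + 1 - q)" using k by (intro dumont2_odd[OF D]) (auto simp: xk)
    then show "\<sigma> q < q" using \<sigma>(1)[of q] q by linarith
  next
    fix q assume q: "odd q" "q \<le> 2 * k"
    then have "1 \<le> q" by (cases q) auto
    then have "\<pi> (x + 1 - q) < x + 1 - q" using k q by (intro dumont2_even[OF D]) (auto simp: xk)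
    then show "q \<le> \<sigma> q" using \<sigma>(1)[of q] \<open>1 \<le> q\<close> q by linarith
  qed
  moreover have False
    if h: "1 \<le> i" "i < j" "j < m" "m < l" "l \<le> 2 * k" "\<sigma> j < \<sigma> l" "\<sigma> l < \<sigma> i" "\<sigma> i < \<sigma> m" for i j m l
  proof -
    define r where "r q = \<pi> (x + 1 - q)" for q
    note \<sigma>r = \<sigma>(1)[folded r_def]
    have "r m < r i" "r i < r l" "r l < r j"
      using h \<sigma>r[of i] \<sigma>r[of j] \<sigma>r[of m] \<sigma>r[of l] by linarith+
    moreover have "1 \<le> x + 1 - l" "x + 1 - l < x + 1 - m" "x + 1 - m < x + 1 - j"
      "x + 1 - j < x + 1 - i" "x + 1 - i \<le> 2 * Suc n"
      using h k by (auto simp: xk)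
    ultimately show False unfolding r_def using av by blast
  qed
  ultimately have \<sigma>_mem: "\<sigma> \<in> dumont2_avoiding k [3, 1, 4, 2]" unfolding dumont2_3142_iff by blast
  have "\<tau> permutes {1..2 * (n - k)}"
  proof (rule inj_imp_permutes)
    show "inj_on \<tau> {1..2 * (n - k)}"
    proof (rule inj_onI)
      fix q r assume h: "q \<in> {1..2 * (n - k)}" "r \<in> {1..2 * (n - k)}" "\<tau> q = \<tau> r"
      then have "\<pi> (q + x) = \<pi> (r + x)" using \<tau>(1)[of q] \<tau>(1)[of r] by auto
      then show "q = r" by (simp add: inj_iff)
    qed
  qed (use \<tau> in \<open>auto simp: \<tau>_def\<close>)
  then have "\<tau> \<in> dumont2 (n - k)"
  proof (rule dumont2I)
    fix q assume q: "even q" "1 \<le> q" "q \<le> 2 * (n - k)"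
    then have "\<pi> (q + x) < q + x" using \<open>even x\<close> k by (intro dumont2_even[OF D]) (auto simp: xk)
    then show "\<tau> q < q" using \<tau>(1)[of q] q by linarith
  next
    fix q assume q: "odd q" "q \<le> 2 * (n - k)"
    then have "1 \<le> q" by (cases q) auto
    have "q + x \<le> \<pi> (q + x)" using \<open>even x\<close> k q by (intro dumont2_odd[OF D]) (auto simp: xk)
    then show "q \<le> \<tau> q" using \<tau>(1)[of q] \<open>1 \<le> q\<close> q by linarith
  qed
  moreover have False
    if h: "1 \<le> i" "i < j" "j < m" "m < l" "l \<le> 2 * (n - k)" "\<tau> j < \<tau> l" "\<tau> l < \<tau> i" "\<tau> i < \<tau> m" for i j m l
  proof -
    have "\<pi> (j + x) < \<pi> (l + x)" "\<pi> (l + x) < \<pi> (i + x)" "\<pi> (i + x) < \<pi> (m + x)"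
      using h \<tau>(1)[of i] \<tau>(1)[of j] \<tau>(1)[of m] \<tau>(1)[of l] by linarith+
    moreover have "1 \<le> i + x" "i + x < j + x" "j + x < m + x" "m + x < l + x" "l + x \<le> 2 * Suc n"
      using h k by (auto simp: xk)
    ultimately show False using av by blast
  qed
  ultimately have \<tau>_mem: "\<tau> \<in> dumont2_avoiding (n - k) [3, 1, 4, 2]" unfolding dumont2_3142_iff by blast
  have "\<pi> = combine k \<sigma> \<tau>"
  proof
    fix q
    consider "q = 0" | "q = 1" | "q = 2" | "3 \<le> q" "q \<le> x" | "x < q" "q \<le> 2 * Suc n" | "2 * Suc n < q"
      by linarith
    then show "\<pi> q = combine k \<sigma> \<tau> q"
    proof cases
      case 1
      then show ?thesis using permutes_not_in[OF p, of 0] by (simp add: combine_def)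
    next
      case 2
      then show ?thesis using xk by (simp add: combine_def x_def)
    next
      case 3
      then show ?thesis using \<pi>2 by (simp add: combine_def)
    next
      case 4
      then have "\<sigma> (x + 1 - q) + \<pi> q = x" using \<sigma>(1)[of "x + 1 - q"] by (simp add: xk)
      then have "\<pi> q = x - \<sigma> (x + 1 - q)" by simp
      moreover have "2 * k + 2 = x" "2 * k + 3 = x + 1" by (simp_all add: xk)
      ultimately show ?thesis using 4 by (simp only: combine_def) simp
    next
      case 5
      then have "1 \<le> q - x" "q - x \<le> 2 * (n - k)" by (auto simp: xk)
      from \<tau>(1)[OF this] 5 have "\<pi> q = x + \<tau> (q - x)" by simp
      then show ?thesis using 5 by (simp add: combine_def xk)
    next
      case 6
      \<comment> \<open>Here \<open>q - x\<close> lies beyond the range of \<tau>, so \<tau> fixes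
        it and the two shifts by \<open>x\<close> cancel.\<close>
      then have "\<pi> q = q" using permutes_not_in[OF p, of q] by simp
      moreover have "\<not> q - x \<le> 2 * (n - k)" using 6 k by (auto simp: xk)
      then have "\<tau> (q - x) = q - x" by (simp add: \<tau>_def)
      moreover have "combine k \<sigma> \<tau> q = x + \<tau> (q - x)" using 6 k by (simp add: combine_def xk)
      ultimately show ?thesis using 6 x by simp
    qed
  qed
  with k \<sigma>_mem \<tau>_mem show thesis by (rule that)
qed

section \<open>Counting 3142-avoiding Dumont permutations\<close>

text \<open>\<open>combine\<close> is a bijection from the triples
  \<open>(k, \<sigma>, \<tau>)\<close>; they form a dependent sum because the sizes of \<sigma> and
  \<tau> vary with \<open>k\<close>.\<close>

lemma card_dumont2_3142_Suc:
  "card (dumont2_avoiding (Suc n) [3, 1, 4, 2]) =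
     (\<Sum>k\<le>n. card (dumont2_avoiding k [3, 1, 4, 2]) * card (dumont2_avoiding (n - k) [3, 1, 4, 2]))"
proof -
  let ?D = "\<lambda>n. dumont2_avoiding n [3, 1, 4, 2]"
  let ?T = "SIGMA k:{..n}. ?D k \<times> ?D (n - k)"
  have perm: "\<pi> permutes {1..2 * m}" if "\<pi> \<in> ?D m" for \<pi> m
    using that dumont2_permutes unfolding dumont2_avoiding_def by blast
  have fin: "finite (?D m)" for m
    by (rule finite_subset[OF _ finite_permutations[of "{1..2 * m}"]]) (use perm in auto)
  have "bij_betw (\<lambda>(k, \<sigma>, \<tau>). combine k \<sigma> \<tau>) ?T (?D (Suc n))"
  proof (rule bij_betw_imageI)
    show "inj_on (\<lambda>(k, \<sigma>, \<tau>). combine k \<sigma> \<tau>) ?T"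
    proof (rule inj_onI)
      fix a b assume ab: "a \<in> ?T" "b \<in> ?T"
        and eq: "(\<lambda>(k, \<sigma>, \<tau>). combine k \<sigma> \<tau>) a = (\<lambda>(k, \<sigma>, \<tau>). combine k \<sigma> \<tau>) b"
      obtain k \<sigma> \<tau> where a: "a = (k, \<sigma>, \<tau>)" by (cases a)
      obtain k' \<sigma>' \<tau>' where b: "b = (k', \<sigma>', \<tau>')" by (cases b)
      have "k = k' \<and> \<sigma> = \<sigma>' \<and> \<tau> = \<tau>'"
      proof (rule combine_inject)
        show "\<sigma> permutes {1..2 * k}" "\<tau> permutes {1..2 * (n - k)}"
          "\<sigma>' permutes {1..2 * k'}" "\<tau>' permutes {1..2 * (n - k')}"
          using ab unfolding a b by (auto intro!: perm simp del: One_nat_def)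
        show "combine k \<sigma> \<tau> = combine k' \<sigma>' \<tau>'" using eq by (simp add: a b)
      qed
      then show "a = b" by (simp add: a b)
    qed
    show "(\<lambda>(k, \<sigma>, \<tau>). combine k \<sigma> \<tau>) ` ?T = ?D (Suc n)"
    proof (intro equalityI subsetI)
      fix \<pi> assume "\<pi> \<in> ?D (Suc n)"
      then show "\<pi> \<in> (\<lambda>(k, \<sigma>, \<tau>). combine k \<sigma> \<tau>) ` ?T" by (elim combineE) force
    qed (auto simp del: One_nat_def intro!: combine_mem)
  qed
  then have "card (?D (Suc n)) = card ?T" by (rule bij_betw_same_card[symmetric])
  also have "\<dots> = (\<Sum>k\<le>n. card (?D k \<times> ?D (n - k)))" by (subst card_SigmaI) (simp_all add: fin del: One_nat_def)
  finally show ?thesis by (simp add: card_cartesian_product)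
qed

text \<open>Strong induction is used because the convolution refers to all smaller sizes.\<close>

lemma card_dumont2_3142: "real (card (dumont2_avoiding n [3, 1, 4, 2])) = catalan n"
proof (induction n rule: less_induct)
  case (less n)
  show ?case
  proof (cases n)
    case 0
    have "dumont2_avoiding 0 [3, 1, 4, 2] = {id}"
      unfolding set_eq_iff dumont2_3142_iff by (simp add: dumont2_def)
    then show ?thesis using 0 by (simp add: catalan_0)
  next
    case (Suc m)
    have "real (card (dumont2_avoiding n [3, 1, 4, 2])) = (\<Sum>k\<le>m. catalan k * catalan (m - k))"
      unfolding Suc card_dumont2_3142_Suc using less Suc by (simp add: less_Suc_eq_le)
    then show ?thesis using Suc by (simp add: catalan_convolution)
  qed
qed

theorem theorem3p4:
  fixes n :: nat
  shows "dumont2_avoiding n [4, 1, 3, 2] = dumont2_avoiding n [3, 2, 1] \<and>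
         real (card (dumont2_avoiding n [4, 1, 3, 2])) = catalan n \<and>
         card (dumont2_avoiding n [4, 1, 3, 2]) = card (dumont2_avoiding n [3, 1, 4, 2])"
proof (intro conjI)
  show eq: "dumont2_avoiding n [4, 1, 3, 2] = dumont2_avoiding n [3, 2, 1]"
    by (rule dumont2_4132_eq_321)
  show cat: "real (card (dumont2_avoiding n [4, 1, 3, 2])) = catalan n"
    unfolding eq card_dumont2_321 by (rule card_ballot_sets_eq_catalan)
  show "card (dumont2_avoiding n [4, 1, 3, 2]) = card (dumont2_avoiding n [3, 1, 4, 2])"
    using cat card_dumont2_3142[of n] by simp
qed

end
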